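(* Let $n,d,k\in\omega\setminus\{0\}$ with $d\le n$. Then \[ H^R_{SR}(n,d,k)=H_{SR}(n,d,k)=\begin{cases}1, & \text{if } d=1,\\ d, & \text{if } k=1,\\ n, & \text{if } k>1 \text{ and } d>1,\end{cases} \] and \[ H^R_{ESR}(n,d,k)=H^R_{AD}(n,d,k)=H^R_{EAD}(n,d,k)=H_{AD}(n,d,k)=H_{AR}(n,d,k)=H_{ESR}(n,d,k)=H_{EAD}(n,d,k)=H_{EAR}(n,d,k)=n. \]
   Context: Let $\omega=\{0,1,2,\dots\}$ and let $\{a_i:i\in\omega\}$ be a set of attributes. A decision rule $r$ is an expression $(a_{i_1}=\delta_1)\wedge\cdots\wedge(a_{i_m}=\delta_m)\to\sigma$ with $m\in\omega$, pairwise different attributes $a_{i_1},\dots,a_{i_m}$, and $\delta_1,\dots,\delta_m,\sigma\in\omega$; $m$ is its length, $\sigma$ its right-hand side, $A(r)=\{a_{i_1},\dots,a_{i_m}\}$ and $K(r)=\{a_{i_1}=\delta_1,\dots,a_{i_m}=\delta_m\}$ (both empty if $m=0$). Two rules are equal iff they have the same $K(\cdot)$ and the same right-hand side. A decision rule system $S$ is a finite nonempty set of decision rules; $\Sigma$ is the set of all such systems. Let $A(S)=\bigcup_{r\in S}A(r)$, $n(S)=|A(S)|$, $D(Z)$ = set of right-hand sides of rules in $Z\subseteq S$, $d(S)$ = maximum length of a rule in $S$. For $a_i\in A(S)$, $V_S(a_i)=\{\delta:(a_i=\delta)\in\bigcup_{r\in S}K(r)\}$ and $EV_S(a_i)=V_S(a_i)\cup\{*\}$,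 where $*$ is a symbol not in $\omega$. $k(S)=\max\{|V_S(a_i)|:a_i\in A(S)\}$ if $n(S)>0$, and $k(S)=0$ if $n(S)=0$. A set of equations $\{a_{i_1}=\delta_1,\dots,a_{i_m}=\delta_m\}$ with $\delta_j\in\omega\cup\{*\}$ is inconsistent if there are $l\neq t$ with $i_l=i_t$ and $\delta_l\ne\delta_t$, and consistent otherwise. A decision tree over $S$ is a finite directed rooted tree in which each working (non-terminal) node is labeled with an attribute from $A(S)$ and each terminal node is labeled with a subset of $S$. In an o-tree, a working node labeled $a_i$ has exactly $|V_S(a_i)|$ outgoing edges, labeled with pairwise distinct elements of $V_S(a_i)$. In an e-tree, it has exactly $|EV_S(a_i)|$ outgoing edges, labeled with pairwise distinct elements of $EV_S(a_i)$. For a complete path $\xi$ (from the root to a terminal node), $K(\xi)$ is the set of equations $a_i=\delta$ such that $a_i$ labels a working node of $\xi$ and $\delta$ labels the edge of $\xi$ leaving that node. $\tau(\xi)$ is the set of rules labeling the terminal node of $\xi$, and $h(\xi)$ is the number of working nodes of $\xi$. The depth $h(\Gamma)$ is the maximum of $h(\xi)$ over all complete paths. An o-tree (resp. e-tree) $\Gamma$ over $S$ solves $AR(S)$ (resp. $EAR(S)$) if every complete path $\xi$ with $K(\xi)$ consistent satisfies: $K(r)\subseteq K(\xi)$ for all $r\in\tau(\xi)$, and $K(r)\cup K(\xi)$ is inconsistent for all $r\in S\setminus\tau(\xi)$. It solves $AD(S)$ (resp. $EAD(S)$) if every such $\xi$ satisfies: $K(r)\subseteq K(\xi)$ for all $r\in\tau(\xi)$,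 and $K(r)\cup K(\xi)$ is inconsistent for every $r\in S\setminus\tau(\xi)$ whose right-hand side does not belong to $D(\tau(\xi))$. It solves $SR(S)$ (resp. $ESR(S)$) if every such $\xi$ satisfies: $K(r)\subseteq K(\xi)$ for all $r\in\tau(\xi)$, and if $\tau(\xi)=\emptyset$ then $K(r)\cup K(\xi)$ is inconsistent for every $r\in S$. For $C\in\{AR,EAR,AD,EAD,SR,ESR\}$, $h_C(S)$ is the minimum depth of a decision tree over $S$ solving $C(S)$. If $n(S)=0$, this is $0$. $R_{SR}(S)$ is the set of $r\in S$ for which there is no $r'\in S$ with $K(r')\subsetneq K(r)$, and $S$ is SR-reduced if $R_{SR}(S)=S$. $R_{AD}(S)$ is the set of $r\in S$ for which there is no $r'\in S$ with the same right-hand side as $r$ and $K(r')\subsetneq K(r)$, and $S$ is AD-reduced if $R_{AD}(S)=S$. $\Sigma_{SR}$ and $\Sigma_{AD}$ denote the sets of SR-reduced and AD-reduced systems, respectively. For $C\in\{SR,ESR,AD,EAD,AR,EAR\}$ and $n,d,k\in\omega\setminus\{0\}$ with $d\le n$: $h_C(n,d,k)=\min\{h_C(S):S\in\Sigma,\ n(S)=n,\ d(S)=d,\ k(S)=k\}$ and $H_C(n,d,k)$ is the corresponding maximum. For $C\in\{SR,ESR,AD,EAD\}$, let $C'=SR$ if $C\in\{SR,ESR\}$ and $C'=AD$ if $C\in\{AD,EAD\}$. Then $h^R_C(n,d,k)$ and $H^R_C(n,d,k)$ are the same minimum and maximum taken over $S\in\Sigma_{C'}$. *)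

theory Defs
  imports Main
begin

text \<open>
  The attribute \<open>a\<^sub>i\<close> is represented by its index \<open>i\<close>. An equation
  \<open>a\<^sub>i = \<delta>\<close> is the pair \<open>(i, Some \<delta>)\<close> for \<open>\<delta> \<in> \<omega>\<close>
  and \<open>(i, None)\<close> when the value is the extra symbol \<open>*\<close>.
\<close>

type_synonym attr = nat
type_synonym equation = "attr \<times> nat option"

definition inconsistent :: "equation set \<Rightarrow> bool" where
  "inconsistent E \<longleftrightarrow> (\<exists>i \<delta> \<delta>'. (i, \<delta>) \<in> E \<and> (i, \<delta>') \<in> E \<and> \<delta> \<noteq> \<delta>')"

text \<open>
  Rules are identified when they have the same set of equations and the same right-hand side,
  so the left-hand side is stored as a set and not as a list.
\<close>

datatype decision_rule = Rule (conds: "(attr \<times> nat) set") (rhs: nat)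

definition is_decision_rule :: "decision_rule \<Rightarrow> bool" where
  "is_decision_rule r \<longleftrightarrow> finite (conds r) \<and> inj_on fst (conds r)"

definition rule_length :: "decision_rule \<Rightarrow> nat" where
  "rule_length r = card (conds r)"

definition rule_attrs :: "decision_rule \<Rightarrow> attr set" where
  "rule_attrs r = fst ` conds r"

definition rule_eqs :: "decision_rule \<Rightarrow> equation set" where
  "rule_eqs r = (\<lambda>(i, \<delta>). (i, Some \<delta>)) ` conds r"

type_synonym rule_system = "decision_rule set"

definition rule_systems :: "rule_system set" where
  "rule_systems = {S. finite S \<and> S \<noteq> {} \<and> (\<forall>r\<in>S. is_decision_rule r)}"

definition attrs :: "rule_system \<Rightarrow> attr set" where
  "attrs S = (\<Union>r\<in>S. rule_attrs r)"

definition num_attrs :: "rule_system \<Rightarrow> nat" where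
  "num_attrs S = card (attrs S)"

definition max_length :: "rule_system \<Rightarrow> nat" where
  "max_length S = Max (rule_length ` S)"

definition vals :: "rule_system \<Rightarrow> attr \<Rightarrow> nat set" where
  "vals S a = {\<delta>. (a, \<delta>) \<in> (\<Union>r\<in>S. conds r)}"

definition max_vals :: "rule_system \<Rightarrow> nat" where
  "max_vals S = (if num_attrs S > 0 then Max ((\<lambda>a. card (vals S a)) ` attrs S) else 0)"

definition o_labels :: "rule_system \<Rightarrow> attr \<Rightarrow> nat option set" where
  "o_labels S a = Some ` vals S a"

definition e_labels :: "rule_system \<Rightarrow> attr \<Rightarrow> nat option set" where
  "e_labels S a = Some ` vals S a \<union> {None}"

text \<open>A working node carries the list of its outgoing edges, each with its label and the
  subtree it leads to.\<close>

datatype dtree =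
    Terminal "decision_rule set"
  | Working attr "(nat option \<times> dtree) list"

inductive tree_over :: "(attr \<Rightarrow> nat option set) \<Rightarrow> rule_system \<Rightarrow> dtree \<Rightarrow> bool"
  for L :: "attr \<Rightarrow> nat option set" and S :: rule_system where
  terminal: "Z \<subseteq> S \<Longrightarrow> tree_over L S (Terminal Z)"
| working: "a \<in> attrs S \<Longrightarrow> length es = card (L a) \<Longrightarrow> distinct (map fst es) \<Longrightarrow>
    fst ` set es \<subseteq> L a \<Longrightarrow> (\<And>\<delta> t. (\<delta>, t) \<in> set es \<Longrightarrow> tree_over L S t) \<Longrightarrow>
    tree_over L S (Working a es)"

definition o_tree :: "rule_system \<Rightarrow> dtree \<Rightarrow> bool" where
  "o_tree S \<Gamma> \<longleftrightarrow> tree_over (o_labels S) S \<Gamma>"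

definition e_tree :: "rule_system \<Rightarrow> dtree \<Rightarrow> bool" where
  "e_tree S \<Gamma> \<longleftrightarrow> tree_over (e_labels S) S \<Gamma>"

text \<open>
  \<open>complete_path \<Gamma> p Z\<close>: some path of \<open>\<Gamma>\<close> from the root to a terminal node
  labelled \<open>Z\<close> passes exactly the (attribute, edge label) pairs in \<open>p\<close>. Thus
  \<open>K(\<xi>)\<close> is \<open>set p\<close>, \<open>\<tau>(\<xi>)\<close> is \<open>Z\<close> and
  \<open>h(\<xi>)\<close> is \<open>length p\<close>.
\<close>

inductive complete_path :: "dtree \<Rightarrow> equation list \<Rightarrow> decision_rule set \<Rightarrow> bool" where
  terminal: "complete_path (Terminal Z) [] Z"
| working: "(\<delta>, t) \<in> set es \<Longrightarrow> complete_path t p Z \<Longrightarrow>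
    complete_path (Working a es) ((a, \<delta>) # p) Z"

definition depth :: "dtree \<Rightarrow> nat" where
  "depth \<Gamma> = Max {length p |p Z. complete_path \<Gamma> p Z}"

datatype problem = SR | ESR | AD | EAD | AR | EAR

definition SR_path :: "rule_system \<Rightarrow> equation set \<Rightarrow> decision_rule set \<Rightarrow> bool" where
  "SR_path S E Z \<longleftrightarrow> (\<forall>r\<in>Z. rule_eqs r \<subseteq> E) \<and>
     (Z = {} \<longrightarrow> (\<forall>r\<in>S. inconsistent (rule_eqs r \<union> E)))"

definition AD_path :: "rule_system \<Rightarrow> equation set \<Rightarrow> decision_rule set \<Rightarrow> bool" where
  "AD_path S E Z \<longleftrightarrow> (\<forall>r\<in>Z. rule_eqs r \<subseteq> E) \<and>
     (\<forall>r\<in>S - Z. rhs r \<notin> rhs ` Z \<longrightarrow> inconsistent (rule_eqs r \<union> E))"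

definition AR_path :: "rule_system \<Rightarrow> equation set \<Rightarrow> decision_rule set \<Rightarrow> bool" where
  "AR_path S E Z \<longleftrightarrow> (\<forall>r\<in>Z. rule_eqs r \<subseteq> E) \<and>
     (\<forall>r\<in>S - Z. inconsistent (rule_eqs r \<union> E))"

definition all_consistent_paths ::
    "(equation set \<Rightarrow> decision_rule set \<Rightarrow> bool) \<Rightarrow> dtree \<Rightarrow> bool" where
  "all_consistent_paths P \<Gamma> \<longleftrightarrow>
     (\<forall>p Z. complete_path \<Gamma> p Z \<longrightarrow> \<not> inconsistent (set p) \<longrightarrow> P (set p) Z)"

fun solves :: "problem \<Rightarrow> rule_system \<Rightarrow> dtree \<Rightarrow> bool" where
  "solves SR S \<Gamma> \<longleftrightarrow> o_tree S \<Gamma> \<and> all_consistent_paths (SR_path S) \<Gamma>"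
| "solves ESR S \<Gamma> \<longleftrightarrow> e_tree S \<Gamma> \<and> all_consistent_paths (SR_path S) \<Gamma>"
| "solves AD S \<Gamma> \<longleftrightarrow> o_tree S \<Gamma> \<and> all_consistent_paths (AD_path S) \<Gamma>"
| "solves EAD S \<Gamma> \<longleftrightarrow> e_tree S \<Gamma> \<and> all_consistent_paths (AD_path S) \<Gamma>"
| "solves AR S \<Gamma> \<longleftrightarrow> o_tree S \<Gamma> \<and> all_consistent_paths (AR_path S) \<Gamma>"
| "solves EAR S \<Gamma> \<longleftrightarrow> e_tree S \<Gamma> \<and> all_consistent_paths (AR_path S) \<Gamma>"

text \<open>The depths of the trees that solve a problem are in general unbounded, so the minimum is
  taken with \<open>LEAST\<close> (\<open>Min\<close> is meaningful on finite sets only).\<close>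

definition min_depth :: "problem \<Rightarrow> rule_system \<Rightarrow> nat" where
  "min_depth C S = (if num_attrs S = 0 then 0 else (LEAST m. \<exists>\<Gamma>. solves C S \<Gamma> \<and> depth \<Gamma> = m))"

definition R_SR :: "rule_system \<Rightarrow> rule_system" where
  "R_SR S = {r\<in>S. \<not> (\<exists>r'\<in>S. rule_eqs r' \<subset> rule_eqs r)}"

definition R_AD :: "rule_system \<Rightarrow> rule_system" where
  "R_AD S = {r\<in>S. \<not> (\<exists>r'\<in>S. rhs r' = rhs r \<and> rule_eqs r' \<subset> rule_eqs r)}"

definition SR_reduced_systems :: "rule_system set" where
  "SR_reduced_systems = {S\<in>rule_systems. R_SR S = S}"

definition AD_reduced_systems :: "rule_system set" where
  "AD_reduced_systems = {S\<in>rule_systems. R_AD S = S}"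

text \<open>No reduced systems are associated with \<open>AR\<close> and \<open>EAR\<close>.\<close>

primrec (nonexhaustive) reduced_systems :: "problem \<Rightarrow> rule_system set" where
  "reduced_systems SR = SR_reduced_systems"
| "reduced_systems ESR = SR_reduced_systems"
| "reduced_systems AD = AD_reduced_systems"
| "reduced_systems EAD = AD_reduced_systems"

definition max_depth_on :: "rule_system set \<Rightarrow> problem \<Rightarrow> nat \<Rightarrow> nat \<Rightarrow> nat \<Rightarrow> nat" where
  "max_depth_on \<S> C n d k =
     Max {min_depth C S |S. S \<in> \<S> \<and> num_attrs S = n \<and> max_length S = d \<and> max_vals S = k}"

definition H :: "problem \<Rightarrow> nat \<Rightarrow> nat \<Rightarrow> nat \<Rightarrow> nat" where
  "H C n d k = max_depth_on rule_systems C n d k"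

definition HR :: "problem \<Rightarrow> nat \<Rightarrow> nat \<Rightarrow> nat \<Rightarrow> nat" where
  "HR C n d k = max_depth_on (reduced_systems C) C n d k"

end

theory Submission
  imports Defs
begin

text \<open>
  Upper bounds: asking all attributes decides every rule, and for \<open>SR\<close> it suffices to ask the
  attributes of one rule if \<open>k = 1\<close>, and any single attribute if \<open>d = 1\<close>.

  Lower bounds come from adversaries against systems consisting of rules of length exactly \<open>d\<close>;
  equal lengths make such a system reduced for free. Against all rules of length \<open>d\<close>, answering
  \<open>0\<close> throughout forces \<open>d\<close> questions for \<open>SR\<close>, and \<open>n\<close> questions for \<open>AD\<close> if different
  conditions have different right-hand sides, since every rule with zero conditions must be output.
  For \<open>ESR\<close> the answer \<open>*\<close> is used from the \<open>d\<close>-th question on. If \<open>d, k > 1\<close>, dropping the rules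
  with zero conditions only forces \<open>n\<close> questions for \<open>SR\<close>.
\<close>

section \<open>Uniform treatment of the six problems\<close>

definition labels :: "problem \<Rightarrow> rule_system \<Rightarrow> attr \<Rightarrow> nat option set" where
  "labels C S = (if C \<in> {SR, AD, AR} then o_labels S else e_labels S)"

primrec correct :: "problem \<Rightarrow> rule_system \<Rightarrow> equation set \<Rightarrow> decision_rule set \<Rightarrow> bool" where
  "correct SR = SR_path"
| "correct ESR = SR_path"
| "correct AD = AD_path"
| "correct EAD = AD_path"
| "correct AR = AR_path"
| "correct EAR = AR_path"

text \<open>The six problems combine two kinds of edge labels with three path conditions. Separating
  these as \<open>labels\<close> and \<open>correct\<close> lets the bounds be proved for a variable
  problem \<open>C\<close>.\<close>

lemma solves_iff:
  "solves C S \<Gamma> \<longleftrightarrow> tree_over (labels C S) S \<Gamma> \<and> all_consistent_paths (correct C S) \<Gamma>"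
  by (cases C) (auto simp: labels_def o_tree_def e_tree_def)

text \<open>The \<open>AR\<close> condition is the strongest of the three, so one tree satisfying it
  yields the upper bound for every problem.\<close>

lemma AR_path_imp_correct: "AR_path S E Z \<Longrightarrow> correct C S E Z"
  by (cases C) (auto simp: AR_path_def AD_path_def SR_path_def)

lemma correct_imp_AD_path:
  "C \<in> {AD, EAD, AR, EAR} \<Longrightarrow> correct C S E Z \<Longrightarrow> AD_path S E Z"
  by (cases C) (auto simp: AR_path_def AD_path_def)

text \<open>The \<open>SR\<close> condition is the weakest: an empty output has no right-hand sides,
  so the other two conditions also force every rule to be refuted. Lower bounds for
  \<open>ESR\<close> thereby carry over to \<open>EAD\<close> and \<open>EAR\<close>.\<close>

lemma correct_imp_SR_path: "correct C S E Z \<Longrightarrow> SR_path S E Z"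
  by (cases C) (auto simp: AR_path_def AD_path_def SR_path_def)

lemma finite_attrs: "S \<in> rule_systems \<Longrightarrow> finite (attrs S)"
  by (auto simp: rule_systems_def attrs_def rule_attrs_def is_decision_rule_def)

lemma finite_vals:
  assumes "S \<in> rule_systems"
  shows "finite (vals S a)"
proof -
  have "finite (\<Union>r\<in>S. conds r)"
    using assms by (auto simp: rule_systems_def is_decision_rule_def)
  moreover have "vals S a \<subseteq> snd ` (\<Union>r\<in>S. conds r)"
    by (force simp: vals_def)
  ultimately show ?thesis by (meson finite_imageI finite_subset)
qed

lemma vals_nonempty: "a \<in> attrs S \<Longrightarrow> vals S a \<noteq> {}"
  by (fastforce simp: attrs_def rule_attrs_def vals_def)

lemma finite_labels: "S \<in> rule_systems \<Longrightarrow> finite (labels C S a)"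
  by (simp add: labels_def o_labels_def e_labels_def finite_vals)

lemma labels_nonempty: "a \<in> attrs S \<Longrightarrow> labels C S a \<noteq> {}"
  by (simp add: labels_def o_labels_def e_labels_def vals_nonempty)

lemma Some_in_labels_iff: "Some v \<in> labels C S a \<longleftrightarrow> v \<in> vals S a"
  by (auto simp: labels_def o_labels_def e_labels_def)

lemma None_in_labels: "C \<in> {ESR, EAD, EAR} \<Longrightarrow> None \<in> labels C S a"
  by (auto simp: labels_def e_labels_def)

lemma card_rule_eqs: "card (rule_eqs r) = card (conds r)"
  unfolding rule_eqs_def by (rule card_image) (auto simp: inj_on_def)

section \<open>Complete paths and adversaries\<close>

inductive_cases complete_path_TerminalE: "complete_path (Terminal Y) p Z"
inductive_cases complete_path_WorkingE: "complete_path (Working a es) p Z"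

text \<open>Finiteness is what makes the \<open>Max\<close> in \<open>depth\<close> an actual
  maximum.\<close>

lemma finite_complete_paths: "finite {(p, Z). complete_path \<Gamma> p Z}"
proof (induction \<Gamma>)
  case (Terminal Z)
  have "{(p, Y). complete_path (Terminal Z) p Y} \<subseteq> {([], Z)}"
    by (auto elim!: complete_path_TerminalE)
  then show ?case by (rule finite_subset) simp
next
  case (Working a es)
  let ?paths = "\<lambda>t. {(p, Y). complete_path t p Y}"
  have "?paths (Working a es) \<subseteq>
      (\<Union>e\<in>set es. (\<lambda>(p, Y). ((a, fst e) # p, Y)) ` ?paths (snd e))"
  proof clarify
    fix p Y assume "complete_path (Working a es) p Y"
    then obtain \<delta> t q where "p = (a, \<delta>) # q" "(\<delta>, t) \<in> set es" "complete_path t q Y"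
      by (rule complete_path_WorkingE)
    then show "(p, Y) \<in> (\<Union>e\<in>set es. (\<lambda>(p, Y). ((a, fst e) # p, Y)) ` ?paths (snd e))"
      by (intro UN_I[of "(\<delta>, t)"]) auto
  qed
  moreover have "finite \<dots>"
  proof (intro finite_UN_I finite_set finite_imageI)
    show "finite (?paths (snd e))" if "e \<in> set es" for e
      using Working.IH[OF that] by (simp add: snds.simps)
  qed
  ultimately show ?case by (rule finite_subset)
qed

lemma finite_path_lengths: "finite {length p |p Z. complete_path \<Gamma> p Z}"
proof -
  have "{length p |p Z. complete_path \<Gamma> p Z} = (length \<circ> fst) ` {(p, Z). complete_path \<Gamma> p Z}"
    by force
  then show ?thesis by (simp add: finite_complete_paths)
qed

lemma tree_over_complete_path_subset:
  "complete_path \<Gamma> p Z \<Longrightarrow> tree_over L S \<Gamma> \<Longrightarrow> Z \<subseteq> S"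
proof (induction rule: complete_path.induct)
  case (terminal Z)
  then show ?case by (auto elim: tree_over.cases)
next
  case (working \<delta> t es p Z a)
  from working.prems have "tree_over L S t"
    using working.hyps(1) by (auto elim: tree_over.cases)
  then show ?case by (rule working.IH)
qed

text \<open>An adversary is given by an invariant of the set of answers so far that survives every
  further query.\<close>

lemma adversary_path:
  assumes "tree_over L S \<Gamma>" and "I E"
    and "\<And>E a. I E \<Longrightarrow> a \<in> attrs S \<Longrightarrow> \<exists>v\<in>L a. I (insert (a, v) E)"
    and "\<And>a. a \<in> attrs S \<Longrightarrow> finite (L a)"
  shows "\<exists>p Z. complete_path \<Gamma> p Z \<and> I (E \<union> set p)"
  using assms(1,2)
proof (induction arbitrary: E rule: tree_over.induct)
  case (terminal Z)
  then show ?case using complete_path.terminal by fastforce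
next
  case (working a es)
  obtain v where v: "v \<in> L a" "I (insert (a, v) E)"
    using assms(3)[OF working.prems working.hyps(1)] by (rule bexE)
  \<comment> \<open>Distinct edge labels, as many as the finite set \<open>L a\<close> has elements
    and all taken from it, must exhaust it. Hence the adversary's answer \<open>v\<close> labels an
    edge.\<close>
  have "card (fst ` set es) = card (L a)"
    using distinct_card[OF working.hyps(3)] working.hyps(2) by simp
  then have "fst ` set es = L a"
    using working.hyps(1,4) by (simp add: assms(4) card_subset_eq)
  then obtain t where t: "(v, t) \<in> set es" using v(1) by force
  from working.IH[OF this v(2)] obtain p Z
    where "complete_path t p Z" "I (insert (a, v) E \<union> set p)"
    by (elim exE conjE)
  with t show ?case
    by (intro exI[of _ "(a, v) # p"] exI[of _ Z]) (auto intro: complete_path.working)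
qed

section \<open>Nonadaptive trees and general bounds\<close>

text \<open>The tree asks a fixed list of attributes whatever the answers are. The argument
  \<open>E\<close> accumulates the answers, so that a terminal node can output every rule already
  satisfied; \<open>ls\<close> enumerates the edge labels because edges are stored as a
  list.\<close>

fun query_tree ::
    "(attr \<Rightarrow> nat option list) \<Rightarrow> rule_system \<Rightarrow> attr list \<Rightarrow> equation set \<Rightarrow> dtree" where
  "query_tree ls S [] E = Terminal {r\<in>S. rule_eqs r \<subseteq> E}"
| "query_tree ls S (a # as) E =
    Working a (map (\<lambda>v. (v, query_tree ls S as (insert (a, v) E))) (ls a))"

lemma tree_over_query_tree:
  assumes "set as \<subseteq> attrs S" and "\<And>a. set (ls a) = L a" and "\<And>a. distinct (ls a)"
  shows "tree_over L S (query_tree ls S as E)"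
  using assms(1)
proof (induction as arbitrary: E)
  case Nil
  then show ?case by (auto intro: tree_over.terminal)
next
  case (Cons a as)
  have "length (ls a) = card (L a)" using assms(2,3) by (metis distinct_card)
  with Cons show ?case
    by (auto intro!: tree_over.working simp: assms comp_def)
qed

lemma complete_path_query_tree:
  assumes "complete_path (query_tree ls S as E) p Z" and "\<And>a. set (ls a) = L a"
  shows "map fst p = as \<and> (\<forall>(a, v)\<in>set p. v \<in> L a) \<and> Z = {r\<in>S. rule_eqs r \<subseteq> E \<union> set p}"
  using assms(1)
proof (induction as arbitrary: E p)
  case Nil
  then show ?case by (auto elim!: complete_path_TerminalE)
next
  case (Cons a as)
  from Cons.prems obtain v q where "p = (a, v) # q" "v \<in> set (ls a)"
    "complete_path (query_tree ls S as (insert (a, v) E)) q Z"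
    by (auto elim!: complete_path_WorkingE)
  with Cons.IH[of "insert (a, v) E" q] assms(2) show ?case by auto
qed

text \<open>All upper bounds go through this reduction: only the output of all satisfied rules has
  to be checked, and only for consistent answers to \<open>as\<close>.\<close>

lemma ex_solving_tree_of_length:
  assumes S: "S \<in> rule_systems" and as: "set as \<subseteq> attrs S"
    and ok: "\<And>p. map fst p = as \<Longrightarrow> \<forall>(a, v)\<in>set p. v \<in> labels C S a \<Longrightarrow>
      \<not> inconsistent (set p) \<Longrightarrow> correct C S (set p) {r\<in>S. rule_eqs r \<subseteq> set p}"
  shows "\<exists>\<Gamma>. solves C S \<Gamma> \<and> depth \<Gamma> = length as"
proof -
  have "\<forall>a. \<exists>xs. set xs = labels C S a \<and> distinct xs"
    using finite_distinct_list finite_labels[OF S] by blast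
  then obtain ls where ls: "\<And>a. set (ls a) = labels C S a" "\<And>a. distinct (ls a)"
    by metis
  define \<Gamma> where "\<Gamma> = query_tree ls S as {}"
  have tree: "tree_over (labels C S) S \<Gamma>"
    unfolding \<Gamma>_def using as ls by (rule tree_over_query_tree)
  have path: "map fst p = as \<and> (\<forall>(a, v)\<in>set p. v \<in> labels C S a)
      \<and> Z = {r\<in>S. rule_eqs r \<subseteq> set p}"
    if "complete_path \<Gamma> p Z" for p Z
    using complete_path_query_tree[OF that[unfolded \<Gamma>_def], of "labels C S"] ls(1) by simp
  have "solves C S \<Gamma>"
    unfolding solves_iff all_consistent_paths_def
  proof (intro conjI tree allI impI)
    fix p Z assume "complete_path \<Gamma> p Z" "\<not> inconsistent (set p)"
    with path[of p Z] ok[of p] show "correct C S (set p) Z" by simp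
  qed
  moreover have "depth \<Gamma> = length as"
  proof -
    \<comment> \<open>The trivial invariant shows that some complete path exists, so the maximum
      defining the depth is not over the empty set.\<close>
    have "\<exists>p Z. complete_path \<Gamma> p Z \<and> True"
      using tree
      by (rule adversary_path[where I = "\<lambda>_. True"])
        (simp_all add: labels_nonempty ex_in_conv finite_labels[OF S])
    then obtain q Y where q: "complete_path \<Gamma> q Y" by blast
    have "length p = length as" if "complete_path \<Gamma> p Z" for p Z
      using path[OF that] by (metis length_map)
    with q have "{length p |p Z. complete_path \<Gamma> p Z} = {length as}"
      by (intro set_eqI iffI) (fastforce, force)
    then show ?thesis by (simp add: depth_def)
  qed
  ultimately show ?thesis by blast
qed

lemma min_depth_le_length:
  assumes "S \<in> rule_systems" "set as \<subseteq> attrs S"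
    and "\<And>p. map fst p = as \<Longrightarrow> \<forall>(a, v)\<in>set p. v \<in> labels C S a \<Longrightarrow>
      \<not> inconsistent (set p) \<Longrightarrow> correct C S (set p) {r\<in>S. rule_eqs r \<subseteq> set p}"
  shows "min_depth C S \<le> length as"
proof -
  have "\<exists>\<Gamma>. solves C S \<Gamma> \<and> depth \<Gamma> = length as"
    using assms by (rule ex_solving_tree_of_length)
  then have "(LEAST m. \<exists>\<Gamma>. solves C S \<Gamma> \<and> depth \<Gamma> = m) \<le> length as"
    by (rule Least_le)
  then show ?thesis by (simp add: min_depth_def)
qed

text \<open>A rule that is not satisfied has a condition missing from \<open>E\<close>; its
  attribute was asked, so another answer contradicts the condition.\<close>

lemma AR_path_all_attrs:
  assumes "attrs S \<subseteq> fst ` E"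
  shows "AR_path S E {r\<in>S. rule_eqs r \<subseteq> E}"
  unfolding AR_path_def
proof (intro conjI ballI)
  fix r assume "r \<in> S - {r\<in>S. rule_eqs r \<subseteq> E}"
  then obtain a \<delta> where r: "r \<in> S" "(a, \<delta>) \<in> conds r" "(a, Some \<delta>) \<notin> E"
    by (auto simp: rule_eqs_def)
  then have "a \<in> fst ` E" using assms by (force simp: attrs_def rule_attrs_def)
  then obtain v where "(a, v) \<in> E" by auto
  moreover have "(a, Some \<delta>) \<in> rule_eqs r" using r(2) by (force simp: rule_eqs_def)
  ultimately show "inconsistent (rule_eqs r \<union> E)"
    using r(3) unfolding inconsistent_def by blast
qed auto

lemma ex_solving_tree_querying_all:
  assumes "S \<in> rule_systems"
  shows "\<exists>\<Gamma>. solves C S \<Gamma> \<and> depth \<Gamma> = num_attrs S"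
proof -
  obtain as where as: "set as = attrs S" "distinct as"
    using finite_distinct_list[OF finite_attrs[OF assms]] by blast
  have "\<exists>\<Gamma>. solves C S \<Gamma> \<and> depth \<Gamma> = length as"
  proof (rule ex_solving_tree_of_length[OF assms])
    fix p :: "equation list"
    assume "map fst p = as"
    then have "attrs S \<subseteq> fst ` set p" using as(1) by (metis list.set_map order_refl)
    then show "correct C S (set p) {r\<in>S. rule_eqs r \<subseteq> set p}"
      by (intro AR_path_imp_correct AR_path_all_attrs)
  qed (simp add: as)
  then show ?thesis using as by (metis distinct_card num_attrs_def)
qed

lemma min_depth_le_num_attrs: "S \<in> rule_systems \<Longrightarrow> min_depth C S \<le> num_attrs S"
  unfolding min_depth_def
  by (cases "num_attrs S = 0")
    (simp_all add: Least_le[where P = "\<lambda>m. \<exists>\<Gamma>. solves C S \<Gamma> \<and> depth \<Gamma> = m"]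
      ex_solving_tree_querying_all)

text \<open>This is the interface for all adversary arguments. The invariant must imply consistency
  because a solving tree promises nothing on inconsistent paths.\<close>

lemma le_min_depth:
  assumes S: "S \<in> rule_systems" and ne: "attrs S \<noteq> {}" and init: "I {}"
    and step: "\<And>E a. I E \<Longrightarrow> a \<in> attrs S \<Longrightarrow> \<exists>v\<in>labels C S a. I (insert (a, v) E)"
    and consistent: "\<And>E. I E \<Longrightarrow> \<not> inconsistent E"
    and long: "\<And>p Z. I (set p) \<Longrightarrow> Z \<subseteq> S \<Longrightarrow> correct C S (set p) Z \<Longrightarrow> m \<le> length p"
  shows "m \<le> min_depth C S"
proof -
  have "m \<le> depth \<Gamma>" if "solves C S \<Gamma>" for \<Gamma>
  proof -
    have tree: "tree_over (labels C S) S \<Gamma>"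
      and paths: "all_consistent_paths (correct C S) \<Gamma>"
      using that by (simp_all add: solves_iff)
    obtain p Z where p: "complete_path \<Gamma> p Z" "I (set p)"
      using adversary_path[OF tree init step finite_labels[OF S]] by auto
    have "correct C S (set p) Z"
      using paths p consistent by (simp add: all_consistent_paths_def)
    then have "m \<le> length p"
      using long p tree_over_complete_path_subset[OF p(1) tree] by simp
    also have "length p \<le> depth \<Gamma>"
      unfolding depth_def using p(1) by (intro Max_ge finite_path_lengths) blast
    finally show ?thesis .
  qed
  \<comment> \<open>\<open>LEAST\<close> says nothing unless some tree solves the problem.\<close>
  moreover have "\<exists>\<Gamma>. solves C S \<Gamma>"
    using ex_solving_tree_querying_all[OF S] by blast
  ultimately have "m \<le> (LEAST m. \<exists>\<Gamma>. solves C S \<Gamma> \<and> depth \<Gamma> = m)"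
    by (intro LeastI2_ex[where Q = "\<lambda>l. m \<le> l"]) auto
  moreover have "num_attrs S \<noteq> 0"
    using ne finite_attrs[OF S] by (simp add: num_attrs_def)
  ultimately show ?thesis by (simp add: min_depth_def)
qed

section \<open>Upper bounds for \<open>SR\<close> when \<open>k = 1\<close> or
  \<open>d = 1\<close>\<close>

lemma vals_singleton:
  assumes S: "S \<in> rule_systems" and k: "max_vals S = 1" and "v \<in> vals S a" "w \<in> vals S a"
  shows "v = w"
proof -
  have a: "a \<in> attrs S" using assms(3) by (force simp: vals_def attrs_def rule_attrs_def)
  then have "max_vals S = Max ((\<lambda>a. card (vals S a)) ` attrs S)"
    using finite_attrs[OF S] by (auto simp: max_vals_def num_attrs_def card_gt_0_iff)
  then have "card (vals S a) \<le> 1"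
    using a k finite_attrs[OF S] by (metis Max_ge finite_imageI imageI)
  then show ?thesis using assms(3,4) finite_vals[OF S] by (metis One_nat_def card_le_Suc0_iff_eq)
qed

lemma rule_length_le_max_length:
  "S \<in> rule_systems \<Longrightarrow> r \<in> S \<Longrightarrow> rule_length r \<le> max_length S"
  by (simp add: max_length_def rule_systems_def)

text \<open>The rule is asked attribute by attribute; with a single value per attribute it is bound to
  be satisfied.\<close>

lemma min_depth_SR_le_max_length:
  assumes S: "S \<in> rule_systems" and k: "max_vals S = 1"
  shows "min_depth SR S \<le> max_length S"
proof -
  obtain r where r: "r \<in> S" "finite (conds r)"
    using S by (auto simp: rule_systems_def is_decision_rule_def)
  obtain as where as: "set as = rule_attrs r" "distinct as"
    using finite_distinct_list[of "rule_attrs r"] r(2) by (auto simp: rule_attrs_def)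
  have "min_depth SR S \<le> length as"
  proof (rule min_depth_le_length[OF S])
    show "set as \<subseteq> attrs S" using as r(1) by (auto simp: attrs_def)
    fix p :: "equation list"
    assume p: "map fst p = as" "\<forall>(a, v)\<in>set p. v \<in> labels SR S a"
    have "rule_eqs r \<subseteq> set p"
    proof (clarsimp simp: rule_eqs_def)
      fix a \<delta> assume a: "(a, \<delta>) \<in> conds r"
      then have "a \<in> rule_attrs r" by (force simp: rule_attrs_def)
      also have "rule_attrs r = fst ` set p" using p(1) as(1) by (metis list.set_map)
      finally obtain v where v: "(a, v) \<in> set p" by auto
      with p(2) obtain w where "v = Some w" "w \<in> vals S a"
        by (auto simp: labels_def o_labels_def)
      moreover have "\<delta> \<in> vals S a" using a r(1) by (auto simp: vals_def)
      ultimately show "(a, Some \<delta>) \<in> set p" using v vals_singleton[OF S k] by metis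
    qed
    with r(1) show "correct SR S (set p) {r\<in>S. rule_eqs r \<subseteq> set p}"
      by (auto simp: SR_path_def)
  qed
  also have "length as = card (rule_attrs r)" using as by (metis distinct_card)
  also have "\<dots> \<le> rule_length r"
    using r(2) by (simp add: rule_attrs_def rule_length_def card_image_le)
  also have "\<dots> \<le> max_length S" using S r(1) by (rule rule_length_le_max_length)
  finally show ?thesis .
qed

text \<open>In an o-tree any answer about \<open>a\<close> is a value occurring with
  \<open>a\<close> in some rule. If all rules have length one, that equation is the whole left-hand
  side, so the rule is satisfied at once.\<close>

lemma min_depth_SR_le_1:
  assumes S: "S \<in> rule_systems" and d: "max_length S = 1"
  shows "min_depth SR S \<le> 1"
proof (cases "\<exists>r\<in>S. conds r = {}")
  case True
  \<comment> \<open>A rule of length zero can be output without any query.\<close>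
  then have "min_depth SR S \<le> length []"
    using min_depth_le_length[OF S, of "[]" SR] by (auto simp: SR_path_def rule_eqs_def)
  then show ?thesis by simp
next
  case False
  have one: "\<exists>a \<delta>. conds r = {(a, \<delta>)}" if "r \<in> S" for r
  proof -
    have "finite (conds r)" using S that by (auto simp: rule_systems_def is_decision_rule_def)
    with False that rule_length_le_max_length[OF S that] d have "card (conds r) = 1"
      by (metis One_nat_def card_0_eq le_SucE le_zero_eq rule_length_def)
    then show ?thesis by (auto simp: card_1_singleton_iff)
  qed
  obtain r where "r \<in> S" using S by (auto simp: rule_systems_def)
  then obtain a \<delta> where r: "r \<in> S" "conds r = {(a, \<delta>)}" using one by blast
  have "min_depth SR S \<le> length [a]"
  proof (rule min_depth_le_length[OF S])
    show "set [a] \<subseteq> attrs S" using r by (force simp: attrs_def rule_attrs_def)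
    fix p :: "equation list"
    assume "map fst p = [a]" "\<forall>(a, v)\<in>set p. v \<in> labels SR S a"
    then obtain w where p: "p = [(a, Some w)]" "w \<in> vals S a"
      by (auto simp: labels_def o_labels_def)
    from p(2) obtain r' where "r' \<in> S" "(a, w) \<in> conds r'" by (auto simp: vals_def)
    with one have "r' \<in> S" "conds r' = {(a, w)}" by fastforce+
    with p(1) show "correct SR S (set p) {r\<in>S. rule_eqs r \<subseteq> set p}"
      by (auto simp: SR_path_def rule_eqs_def)
  qed
  then show ?thesis by simp
qed

section \<open>Systems of rules of equal length\<close>

text \<open>Left-hand sides are graphs of partial functions with domain of size \<open>d\<close>.
  The filter \<open>Q\<close> can remove the all-zero rules, and \<open>g\<close> controls which
  rules share a right-hand side.\<close>

definition uniform_system ::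
    "nat \<Rightarrow> nat \<Rightarrow> nat \<Rightarrow> ((attr \<times> nat) set \<Rightarrow> bool) \<Rightarrow> ((attr \<times> nat) set \<Rightarrow> nat) \<Rightarrow> rule_system" where
  "uniform_system n d k Q g =
    {Rule c (g c) |c. c \<subseteq> {..<n} \<times> {..<k} \<and> inj_on fst c \<and> card c = d \<and> Q c}"

definition graph_on :: "(attr \<Rightarrow> nat) \<Rightarrow> attr set \<Rightarrow> (attr \<times> nat) set" where
  "graph_on f A = (\<lambda>i. (i, f i)) ` A"

lemma mem_graph_on_iff [simp]: "(i, \<delta>) \<in> graph_on f A \<longleftrightarrow> i \<in> A \<and> \<delta> = f i"
  by (auto simp: graph_on_def)

lemma graph_rule_in_uniform_system:
  assumes "A \<subseteq> {..<n}" "card A = d" "f ` A \<subseteq> {..<k}" "Q (graph_on f A)"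
  shows "Rule (graph_on f A) (g (graph_on f A)) \<in> uniform_system n d k Q g"
proof -
  have "card (graph_on f A) = card A" unfolding graph_on_def
    by (rule card_image) (simp add: inj_on_def)
  with assms show ?thesis
    by (force simp: uniform_system_def inj_on_def graph_on_def)
qed

lemma ex_index_set:
  assumes "a < n" "0 < d" "d \<le> n"
  obtains A where "A \<subseteq> {..<n}" "card A = d" "a \<in> A"
  using exists_subset_between[of "{a}" d "{..<n::nat}"] assms by auto

text \<open>The assumption \<open>rich\<close> guarantees that filtering by \<open>Q\<close> loses
  no attribute and no value, which pins the parameters of the system to exactly \<open>n\<close>,
  \<open>d\<close> and \<open>k\<close>.\<close>

locale rich_uniform_system =
  fixes n d k :: nat and Q :: "(attr \<times> nat) set \<Rightarrow> bool" and g :: "(attr \<times> nat) set \<Rightarrow> nat"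
  assumes pos: "0 < d" "d \<le> n" "0 < k"
    and rich: "a < n \<Longrightarrow> \<delta> < k \<Longrightarrow>
      \<exists>A f. A \<subseteq> {..<n} \<and> card A = d \<and> f ` A \<subseteq> {..<k} \<and> Q (graph_on f A) \<and> a \<in> A \<and> f a = \<delta>"
begin

abbreviation "S \<equiv> uniform_system n d k Q g"

lemma uniform_systemE:
  assumes "r \<in> S"
  obtains "conds r \<subseteq> {..<n} \<times> {..<k}" "inj_on fst (conds r)" "card (conds r) = d"
    "Q (conds r)" "rhs r = g (conds r)"
  using assms by (auto simp: uniform_system_def)

lemma ex_rule:
  assumes "a < n" "\<delta> < k"
  shows "\<exists>r\<in>S. (a, \<delta>) \<in> conds r"
proof -
  from rich[OF assms] obtain A f where "A \<subseteq> {..<n}" "card A = d" "f ` A \<subseteq> {..<k}"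
    "Q (graph_on f A)" "a \<in> A" "f a = \<delta>" by blast
  then show ?thesis
    by (intro bexI[OF _ graph_rule_in_uniform_system[of A n d f k Q g]]) auto
qed

lemma decision_rule: "r \<in> S \<Longrightarrow> is_decision_rule r"
  by (erule uniform_systemE) (auto simp: is_decision_rule_def intro: finite_subset)

lemma in_rule_systems: "S \<in> rule_systems"
proof -
  have "S \<subseteq> (\<lambda>c. Rule c (g c)) ` Pow ({..<n} \<times> {..<k})"
    by (auto simp: uniform_system_def)
  then have "finite S" by (rule finite_subset) simp
  moreover have "S \<noteq> {}" using ex_rule[of 0 0] pos by auto
  ultimately show ?thesis using decision_rule by (simp add: rule_systems_def)
qed

lemma vals_eq: "a < n \<Longrightarrow> vals S a = {..<k}"
  using ex_rule by (fastforce simp: vals_def elim: uniform_systemE)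

lemma attrs_eq: "attrs S = {..<n}"
proof
  show "attrs S \<subseteq> {..<n}"
    by (force simp: attrs_def rule_attrs_def elim: uniform_systemE)
  show "{..<n} \<subseteq> attrs S"
    using ex_rule[OF _ pos(3)] by (force simp: attrs_def rule_attrs_def)
qed

lemma attrs_nonempty: "attrs S \<noteq> {}"
proof -
  have "0 \<in> attrs S" using pos by (simp add: attrs_eq)
  then show ?thesis by blast
qed

lemma num_attrs_eq: "num_attrs S = n"
  by (simp add: num_attrs_def attrs_eq)

lemma max_length_eq: "max_length S = d"
proof -
  have "rule_length ` S = {d}"
    using in_rule_systems by (auto simp: rule_length_def rule_systems_def elim: uniform_systemE)
  then show ?thesis by (simp add: max_length_def)
qed

lemma max_vals_eq: "max_vals S = k"
proof -
  have "(\<lambda>a. card (vals S a)) ` attrs S = (\<lambda>_. k) ` attrs S"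
    by (intro image_cong) (simp_all add: attrs_eq vals_eq)
  also have "\<dots> = {k}" using attrs_nonempty by auto
  finally have "(\<lambda>a. card (vals S a)) ` attrs S = {k}" .
  then show ?thesis using pos by (simp add: max_vals_def num_attrs_eq)
qed

lemma SR_reduced: "S \<in> SR_reduced_systems"
proof -
  have "\<not> rule_eqs r' \<subset> rule_eqs r" if "r \<in> S" "r' \<in> S" for r r'
  proof
    assume "rule_eqs r' \<subset> rule_eqs r"
    moreover have "finite (rule_eqs r)"
      using decision_rule[OF that(1)] by (simp add: rule_eqs_def is_decision_rule_def)
    ultimately have "card (conds r') < card (conds r)"
      by (metis card_rule_eqs psubset_card_mono)
    with that show False by (metis uniform_systemE less_irrefl)
  qed
  then show ?thesis by (auto simp: SR_reduced_systems_def in_rule_systems R_SR_def)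
qed

lemma AD_reduced: "S \<in> AD_reduced_systems"
  using SR_reduced by (auto simp: SR_reduced_systems_def AD_reduced_systems_def R_SR_def R_AD_def)

lemma in_reduced_systems: "C \<notin> {AR, EAR} \<Longrightarrow> S \<in> reduced_systems C"
  using SR_reduced AD_reduced by (cases C) auto

text \<open>The answer \<open>0\<close> is always available since \<open>k\<close> is positive, and
  constant answers never contradict each other.\<close>

lemma le_min_depth_zero_answers:
  assumes "\<And>p Z. set p \<subseteq> {..<n} \<times> {Some 0} \<Longrightarrow> Z \<subseteq> S \<Longrightarrow>
    correct C S (set p) Z \<Longrightarrow> m \<le> length p"
  shows "m \<le> min_depth C S"
proof (rule le_min_depth[OF in_rule_systems, where I = "\<lambda>E::equation set. E \<subseteq> {..<n} \<times> {Some 0}"])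
  show "attrs S \<noteq> {}" by (rule attrs_nonempty)
next
  fix E :: "equation set" and a
  assume E: "E \<subseteq> {..<n} \<times> {Some 0}" and a: "a \<in> attrs S"
  then have "Some 0 \<in> labels C S a"
    using pos by (simp add: Some_in_labels_iff attrs_eq vals_eq)
  with E a show "\<exists>v\<in>labels C S a. insert (a, v) E \<subseteq> {..<n} \<times> {Some 0}"
    by (intro bexI[of _ "Some 0"]) (auto simp: attrs_eq)
qed (use assms in \<open>auto simp: inconsistent_def\<close>)

end

section \<open>Lower bounds from uniform systems\<close>

text \<open>Neither the rule nor \<open>E\<close> conflicts with itself, so the conflict pairs a
  condition of the rule with an answer in \<open>E\<close>.\<close>

lemma inconsistent_Un_rule_eqsD:
  assumes "inconsistent (rule_eqs r \<union> E)" "is_decision_rule r" "\<not> inconsistent E"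
  shows "\<exists>i \<delta> v. (i, \<delta>) \<in> conds r \<and> (i, v) \<in> E \<and> v \<noteq> Some \<delta>"
proof -
  have rule: "v = w" if vw: "(i, v) \<in> rule_eqs r" "(i, w) \<in> rule_eqs r" for i v w
  proof -
    obtain \<delta> \<epsilon> where "v = Some \<delta>" "w = Some \<epsilon>" "(i, \<delta>) \<in> conds r" "(i, \<epsilon>) \<in> conds r"
      using vw by (auto simp: rule_eqs_def)
    moreover have "inj_on fst (conds r)" using assms(2) by (simp add: is_decision_rule_def)
    ultimately show ?thesis using inj_onD[of fst "conds r" "(i, \<delta>)" "(i, \<epsilon>)"] by simp
  qed
  have E: "v = w" if "(i, v) \<in> E" "(i, w) \<in> E" for i v w
    using that assms(3) unfolding inconsistent_def by blast
  obtain i v w where "(i, v) \<in> rule_eqs r \<union> E" "(i, w) \<in> rule_eqs r \<union> E" "v \<noteq> w"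
    using assms(1) unfolding inconsistent_def by blast
  then obtain v w where "(i, v) \<in> rule_eqs r" "(i, w) \<in> E" "w \<noteq> v"
    using rule E by (metis UnE)
  then show ?thesis by (auto simp: rule_eqs_def)
qed

lemma length_ge_if_all_queried:
  fixes p :: "equation list"
  assumes "{..<n} \<subseteq> fst ` set p"
  shows "n \<le> length p"
  using assms
  by (metis card_lessThan card_length card_mono finite_set length_map list.set_map
      order_trans)

lemma rich_full_uniform_system:
  assumes "0 < d" "d \<le> n" "0 < k"
  shows "rich_uniform_system n d k (\<lambda>_. True)"
proof
  fix a \<delta> assume a: "a < n" "\<delta> < k"
  then obtain A where "A \<subseteq> {..<n}" "card A = d" "a \<in> A" using ex_index_set assms by metis
  with a show "\<exists>A f. A \<subseteq> {..<n} \<and> card A = d \<and> f ` A \<subseteq> {..<k} \<and> True \<and> a \<in> A \<and> f a = \<delta>"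
    by (intro exI[of _ A] exI[of _ "\<lambda>_. \<delta>"]) auto
qed (use assms in auto)

lemma rich_nonzero_uniform_system:
  assumes "1 < d" "d \<le> n" "1 < k"
  shows "rich_uniform_system n d k (\<lambda>c. \<exists>(a, \<delta>)\<in>c. \<delta> \<noteq> 0)"
proof
  fix a \<delta> assume a: "a < n" "\<delta> < k"
  have "0 < d" using assms by simp
  then obtain A where A: "A \<subseteq> {..<n}" "card A = d" "a \<in> A" using ex_index_set assms a by metis
  \<comment> \<open>Here \<open>d > 1\<close> enters: a rule prescribing \<open>0\<close> at
    \<open>a\<close> needs a second attribute \<open>b\<close> to carry the nonzero value
    \<open>1\<close>, which is available because \<open>k > 1\<close>.\<close>
  have "\<not> A \<subseteq> {a}" using A(2) assms(1) card_mono[of "{a}" A] by auto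
  then obtain b where "b \<in> A" "b \<noteq> a" by auto
  then have "(b, 1) \<in> graph_on (\<lambda>i. if i = a then \<delta> else 1) A" by simp
  then have "\<exists>(b, \<delta>')\<in>graph_on (\<lambda>i. if i = a then \<delta> else 1) A. \<delta>' \<noteq> 0" by force
  with A a assms show "\<exists>A f. A \<subseteq> {..<n} \<and> card A = d \<and> f ` A \<subseteq> {..<k} \<and>
      (\<exists>(a, \<delta>)\<in>graph_on f A. \<delta> \<noteq> 0) \<and> a \<in> A \<and> f a = \<delta>"
    by (intro exI[of _ A] exI[of _ "\<lambda>i. if i = a then \<delta> else 1"]) auto
qed (use assms in auto)

text \<open>Zero answers cannot refute an all-zero rule, so some rule is output, and its
  \<open>d\<close> equations must all lie on the path.\<close>

lemma min_depth_SR_full_ge: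
  assumes "0 < d" "d \<le> n" "0 < k"
  shows "d \<le> min_depth SR (uniform_system n d k (\<lambda>_. True) g)"
proof -
  interpret rich_uniform_system n d k "\<lambda>_. True" g
    using assms by (rule rich_full_uniform_system)
  show ?thesis
  proof (rule le_min_depth_zero_answers)
    fix p Z assume p: "set p \<subseteq> {..<n} \<times> {Some 0}" and Z: "Z \<subseteq> S" and "correct SR S (set p) Z"
    then have SR: "SR_path S (set p) Z" by simp
    define c where "c = graph_on (\<lambda>_. 0) {..<d}"
    have r: "Rule c (g c) \<in> S"
      unfolding c_def using assms by (intro graph_rule_in_uniform_system) auto
    have "Z \<noteq> {}"
    proof
      assume "Z = {}"
      then have "inconsistent (rule_eqs (Rule c (g c)) \<union> set p)"
        using SR r by (simp add: SR_path_def)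
      moreover have "\<not> inconsistent (set p)" using p by (auto simp: inconsistent_def)
      ultimately show False
        using inconsistent_Un_rule_eqsD[OF _ decision_rule[OF r]] p by (fastforce simp: c_def)
    qed
    then obtain r where "r \<in> Z" by blast
    then have "rule_eqs r \<subseteq> set p" "r \<in> S" using SR Z by (auto simp: SR_path_def)
    then have "d \<le> card (set p)"
      by (metis List.finite_set card_mono card_rule_eqs uniform_systemE)
    then show "d \<le> length p" using card_length[of p] by simp
  qed
qed

text \<open>Under zero answers no rule holds, and an unasked attribute belongs to a rule whose only
  nonzero condition is on it.\<close>

lemma min_depth_SR_nonzero_ge:
  assumes "1 < d" "d \<le> n" "1 < k"
  shows "n \<le> min_depth SR (uniform_system n d k (\<lambda>c. \<exists>(a, \<delta>)\<in>c. \<delta> \<noteq> 0) g)"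
proof -
  interpret rich_uniform_system n d k "\<lambda>c. \<exists>(a, \<delta>)\<in>c. \<delta> \<noteq> 0" g
    using assms by (rule rich_nonzero_uniform_system)
  show ?thesis
  proof (rule le_min_depth_zero_answers)
    fix p Z assume p: "set p \<subseteq> {..<n} \<times> {Some 0}" and Z: "Z \<subseteq> S" and "correct SR S (set p) Z"
    then have SR: "SR_path S (set p) Z" by simp
    have "Z = {}"
    proof (rule ccontr)
      assume "Z \<noteq> {}"
      then obtain r where "r \<in> Z" by blast
      then have r: "rule_eqs r \<subseteq> set p" "r \<in> S" using SR Z by (auto simp: SR_path_def)
      then obtain a \<delta> where a: "(a, \<delta>) \<in> conds r" "\<delta> \<noteq> 0"
        by (blast elim: uniform_systemE)
      then have "(a, Some \<delta>) \<in> set p" using r(1) by (force simp: rule_eqs_def)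
      with p a(2) show False by auto
    qed
    have "a \<in> fst ` set p" if a_less: "a < n" for a
    proof (rule ccontr)
      assume a: "a \<notin> fst ` set p"
      obtain A where A: "A \<subseteq> {..<n}" "card A = d" "a \<in> A"
        using ex_index_set[OF a_less] pos by metis
      define c where "c = graph_on (\<lambda>i. if i = a then 1 else 0) A"
      have "(a, 1) \<in> c" using A(3) by (simp add: c_def)
      then have "\<exists>(a, \<delta>)\<in>c. \<delta> \<noteq> 0" by force
      then have r: "Rule c (g c) \<in> S"
        unfolding c_def using A assms by (intro graph_rule_in_uniform_system) auto
      then have "inconsistent (rule_eqs (Rule c (g c)) \<union> set p)"
        using SR \<open>Z = {}\<close> by (simp add: SR_path_def)
      moreover have "\<not> inconsistent (set p)" using p by (auto simp: inconsistent_def)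
      ultimately obtain i \<delta> v where "(i, \<delta>) \<in> c" "(i, v) \<in> set p" "v \<noteq> Some \<delta>"
        using inconsistent_Un_rule_eqsD[OF _ decision_rule[OF r]] by fastforce
      with p a show False by (force simp: c_def split: if_splits)
    qed
    then show "n \<le> length p" by (intro length_ge_if_all_queried) auto
  qed
qed

text \<open>An unasked attribute lies in an all-zero rule, which then cannot be output. Since
  \<open>g\<close> is injective, no output rule shares its right-hand side, so the rule would have
  to be refuted, which zero answers never do.\<close>

lemma min_depth_AD_full_ge:
  assumes "0 < d" "d \<le> n" "0 < k" and inj: "inj_on g (Pow ({..<n} \<times> {..<k}))"
    and C: "C \<in> {AD, AR}"
  shows "n \<le> min_depth C (uniform_system n d k (\<lambda>_. True) g)"
proof -
  interpret rich_uniform_system n d k "\<lambda>_. True" g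
    using assms(1-3) by (rule rich_full_uniform_system)
  show ?thesis
  proof (rule le_min_depth_zero_answers)
    fix p Z assume p: "set p \<subseteq> {..<n} \<times> {Some 0}" and Z: "Z \<subseteq> S" and "correct C S (set p) Z"
    then have AD: "AD_path S (set p) Z" using correct_imp_AD_path C by blast
    have "a \<in> fst ` set p" if a_less: "a < n" for a
    proof (rule ccontr)
      assume a: "a \<notin> fst ` set p"
      obtain A where A: "A \<subseteq> {..<n}" "card A = d" "a \<in> A"
        using ex_index_set[OF a_less] pos by metis
      define c where "c = graph_on (\<lambda>i. 0) A"
      have r: "Rule c (g c) \<in> S"
        unfolding c_def using A assms by (intro graph_rule_in_uniform_system) auto
      have c: "c \<in> Pow ({..<n} \<times> {..<k})" using r by (auto simp: uniform_system_def)
      have "(a, Some 0) \<in> rule_eqs (Rule c (g c))"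
        using A(3) by (force simp: c_def rule_eqs_def)
      then have notin: "Rule c (g c) \<notin> Z" using AD a by (force simp: AD_path_def)
      have "g c \<notin> rhs ` Z"
      proof
        assume "g c \<in> rhs ` Z"
        then obtain r' where r': "r' \<in> Z" "g c = rhs r'" by auto
        with Z obtain c' where c': "r' = Rule c' (g c')" "c' \<in> Pow ({..<n} \<times> {..<k})"
          by (auto simp: uniform_system_def)
        with r' inj c have "c = c'" by (simp add: inj_on_eq_iff)
        with r' c' notin show False by simp
      qed
      with notin r have "inconsistent (rule_eqs (Rule c (g c)) \<union> set p)"
        using AD by (simp add: AD_path_def)
      moreover have "\<not> inconsistent (set p)" using p by (auto simp: inconsistent_def)
      ultimately show False
        using inconsistent_Un_rule_eqsD[OF _ decision_rule[OF r]] p by (fastforce simp: c_def)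
    qed
    then show "n \<le> length p" by (intro length_ge_if_all_queried) auto
  qed
qed

definition zeros :: "equation set \<Rightarrow> attr set" where
  "zeros E = {i. (i, Some 0) \<in> E}"

text \<open>The adversary answers \<open>0\<close> to the first \<open>d - 1\<close> attributes and \<open>*\<close> to all later
  ones: no rule ever holds, and an unasked attribute completes the attributes answered \<open>0\<close> to a
  rule that is still open.\<close>

lemma min_depth_E_full_ge:
  assumes "0 < d" "d \<le> n" "0 < k" and C: "C \<in> {ESR, EAD, EAR}"
  shows "n \<le> min_depth C (uniform_system n d k (\<lambda>_. True) g)"
proof -
  interpret rich_uniform_system n d k "\<lambda>_. True" g
    using assms(1-3) by (rule rich_full_uniform_system)
  \<comment> \<open>Fewer than \<open>d\<close> zeros keep every rule unsatisfied. The last clause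
    records that \<open>*\<close> (that is, \<open>None\<close>) is used only once exactly
    \<open>d - 1\<close> zeros have been given.\<close>
  define I where "I E \<longleftrightarrow> \<not> inconsistent E \<and> E \<subseteq> {..<n} \<times> {Some 0, None} \<and>
    card (zeros E) < d \<and> (None \<in> snd ` E \<longrightarrow> card (zeros E) = d - 1)" for E
  have zeros_sub: "zeros E \<subseteq> {..<n}" if "I E" for E
    using that by (auto simp: I_def zeros_def)
  show ?thesis
  proof (rule le_min_depth[OF in_rule_systems, where I = I])
    show "attrs S \<noteq> {}" by (rule attrs_nonempty)
    show "I {}" using pos by (simp add: I_def zeros_def inconsistent_def)
    show "\<not> inconsistent E" if "I E" for E using that by (simp add: I_def)
  next
    fix E a assume E: "I E" and a: "a \<in> attrs S"
    have L: "None \<in> labels C S a" "Some 0 \<in> labels C S a"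
      using a pos C by (simp_all add: None_in_labels Some_in_labels_iff attrs_eq vals_eq)
    have fin: "finite (zeros E)" using zeros_sub[OF E] finite_subset by blast
    show "\<exists>v\<in>labels C S a. I (insert (a, v) E)"
    \<comment> \<open>A repeated question gets its old answer; a new one gets \<open>0\<close> as
      long as the count of zeros stays below \<open>d\<close>, and \<open>*\<close>
      otherwise.\<close>
    proof (cases "a \<in> fst ` E")
      case True
      then obtain v where v: "(a, v) \<in> E" by auto
      then have "v \<in> labels C S a" using E L by (auto simp: I_def)
      with v E show ?thesis by (metis insert_absorb)
    next
      case False
      then have notin: "(a, v) \<notin> E" for v by force
      then have "a \<notin> zeros E" by (simp add: zeros_def)
      moreover have "\<not> inconsistent (insert (a, v) E)" for v
        using E notin by (auto simp: I_def inconsistent_def)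
      ultimately have new: "a \<notin> zeros E" "\<not> inconsistent (insert (a, v) E)" for v
        by blast+
      show ?thesis
      proof (cases "Suc (card (zeros E)) < d")
        case True
        then have "None \<notin> snd ` E" using E by (auto simp: I_def)
        moreover have "zeros (insert (a, Some 0) E) = insert a (zeros E)"
          by (auto simp: zeros_def)
        ultimately have "I (insert (a, Some 0) E)"
          using E a new True fin by (auto simp: I_def attrs_eq)
        with L show ?thesis by blast
      next
        case False
        moreover have "zeros (insert (a, None) E) = zeros E" by (auto simp: zeros_def)
        ultimately have "I (insert (a, None) E)"
          using E a new by (auto simp: I_def attrs_eq)
        with L show ?thesis by blast
      qed
    qed
  next
    fix p Z assume p: "I (set p)" and Z: "Z \<subseteq> S" and "correct C S (set p) Z"
    then have SR: "SR_path S (set p) Z" using correct_imp_SR_path by blast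
    have fin: "finite (zeros (set p))" using zeros_sub[OF p] finite_subset by blast
    have "Z = {}"
    proof (rule ccontr)
      assume "Z \<noteq> {}"
      then obtain r where "r \<in> Z" by blast
      then have r: "rule_eqs r \<subseteq> set p" "r \<in> S" using SR Z by (auto simp: SR_path_def)
      have "fst ` conds r \<subseteq> zeros (set p)"
      proof
        fix i assume "i \<in> fst ` conds r"
        then obtain \<delta> where "(i, \<delta>) \<in> conds r" by auto
        then have "(i, Some \<delta>) \<in> set p" using r(1) by (force simp: rule_eqs_def)
        with p show "i \<in> zeros (set p)" by (auto simp: I_def zeros_def)
      qed
      then have "card (fst ` conds r) \<le> card (zeros (set p))" by (rule card_mono[OF fin])
      with r(2) p show False by (auto simp: I_def card_image elim!: uniform_systemE)
    qed
    have "a \<in> fst ` set p" if a_less: "a < n" for a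
    proof (rule ccontr)
      assume a: "a \<notin> fst ` set p"
      then have a0: "a \<notin> zeros (set p)" by (force simp: zeros_def)
      have "card (insert a (zeros (set p))) \<le> d" using p fin a0 by (simp add: I_def)
      then obtain A where A: "insert a (zeros (set p)) \<subseteq> A" "A \<subseteq> {..<n}" "card A = d"
        using exists_subset_between[of "insert a (zeros (set p))" d "{..<n}"]
          a_less zeros_sub[OF p] pos by auto
      define c where "c = graph_on (\<lambda>i. 0) A"
      have r: "Rule c (g c) \<in> S"
        unfolding c_def using A assms by (intro graph_rule_in_uniform_system) auto
      then have "inconsistent (rule_eqs (Rule c (g c)) \<union> set p)"
        using SR \<open>Z = {}\<close> by (simp add: SR_path_def)
      moreover have con: "\<not> inconsistent (set p)" using p by (simp add: I_def)
      ultimately obtain i v where i: "i \<in> A" "(i, v) \<in> set p" "v \<noteq> Some 0"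
        using inconsistent_Un_rule_eqsD[OF _ decision_rule[OF r]] by (fastforce simp: c_def)
      with p have N: "(i, None) \<in> set p" by (auto simp: I_def)
      \<comment> \<open>Once \<open>*\<close> has been answered, the zeros and \<open>a\<close>
        already make up \<open>d\<close> attributes. So \<open>A\<close> contains nothing else, in
        particular no attribute answered \<open>*\<close>.\<close>
      then have "card (zeros (set p)) = d - 1" using p by (force simp: I_def)
      then have "card (insert a (zeros (set p))) = card A" using a0 fin A pos by simp
      then have "A = insert a (zeros (set p))"
        using A by (metis card_subset_eq finite_lessThan finite_subset)
      with i a have "(i, Some 0) \<in> set p" by (force simp: zeros_def)
      with N con show False by (auto simp: inconsistent_def)
    qed
    then show "n \<le> length p" by (intro length_ge_if_all_queried) auto
  qed
qed

section \<open>From single systems to the maxima\<close>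

text \<open>The uniform upper bound \<open>m\<close> makes the set of depths finite, and the witness
  \<open>U\<close> attains it.\<close>

lemma max_depth_on_eq:
  assumes "\<S> \<subseteq> rule_systems"
    and "U \<in> \<S>" "num_attrs U = n" "max_length U = d" "max_vals U = k" and "m \<le> min_depth C U"
    and le: "\<And>S. S \<in> rule_systems \<Longrightarrow> num_attrs S = n \<Longrightarrow> max_length S = d \<Longrightarrow> max_vals S = k \<Longrightarrow>
      min_depth C S \<le> m"
  shows "max_depth_on \<S> C n d k = m"
proof -
  let ?M = "{min_depth C S |S. S \<in> \<S> \<and> num_attrs S = n \<and> max_length S = d \<and> max_vals S = k}"
  have "?M \<subseteq> {..m}" using assms(1) le by auto
  moreover have "min_depth C U = m" using assms by (intro antisym le) auto
  then have "m \<in> ?M" using assms by blast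
  ultimately show ?thesis
    unfolding max_depth_on_def by (intro Max_eqI) (auto intro: finite_subset)
qed

lemma reduced_systems_subset: "C \<notin> {AR, EAR} \<Longrightarrow> reduced_systems C \<subseteq> rule_systems"
  by (cases C) (auto simp: SR_reduced_systems_def AD_reduced_systems_def)

text \<open>One witness serves both maxima because uniform systems are reduced. The second claim
  excludes \<open>AR\<close> and \<open>EAR\<close>, for which \<open>reduced_systems\<close> has no
  equation.\<close>

lemma (in rich_uniform_system) H_eq:
  assumes "m \<le> min_depth C S"
    and "\<And>S. S \<in> rule_systems \<Longrightarrow> num_attrs S = n \<Longrightarrow> max_length S = d \<Longrightarrow> max_vals S = k \<Longrightarrow>
      min_depth C S \<le> m"
  shows "H C n d k = m" and "C \<notin> {AR, EAR} \<Longrightarrow> HR C n d k = m"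
  unfolding H_def HR_def
  by (rule max_depth_on_eq[OF _ _ num_attrs_eq max_length_eq max_vals_eq assms];
      simp add: in_rule_systems in_reduced_systems reduced_systems_subset)+

theorem theorem1:
  fixes n d k :: nat
  assumes "n \<noteq> 0" and "d \<noteq> 0" and "k \<noteq> 0" and "d \<le> n"
  shows "HR SR n d k = H SR n d k \<and>
    H SR n d k = (if d = 1 then 1 else if k = 1 then d else n) \<and>
    HR ESR n d k = n \<and> HR AD n d k = n \<and> HR EAD n d k = n \<and>
    H AD n d k = n \<and> H AR n d k = n \<and> H ESR n d k = n \<and>
    H EAD n d k = n \<and> H EAR n d k = n"
proof -
  have pos: "0 < d" "d \<le> n" "0 < k" using assms by auto
  \<comment> \<open>Only finitely many left-hand sides are possible, so they can be numbered to give
    distinct right-hand sides.\<close>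
  obtain g :: "(attr \<times> nat) set \<Rightarrow> nat" where g: "inj_on g (Pow ({..<n} \<times> {..<k}))"
    using finite_imp_inj_to_nat_seg[of "Pow ({..<n} \<times> {..<k})"] by auto
  interpret full: rich_uniform_system n d k "\<lambda>_. True" g
    using pos by (rule rich_full_uniform_system)
  have le_n: "min_depth C S \<le> n" if "S \<in> rule_systems" "num_attrs S = n" for C S
    using min_depth_le_num_attrs that by metis
  have n: "H C n d k = n \<and> (C \<notin> {AR, EAR} \<longrightarrow> HR C n d k = n)" if "C \<noteq> SR" for C
  proof -
    \<comment> \<open>Zero answers settle \<open>AD\<close> and \<open>AR\<close>; the adversary
      using \<open>*\<close> settles the three e-tree problems.\<close>
    have "n \<le> min_depth C full.S"
      using that min_depth_AD_full_ge[OF pos g, of C] min_depth_E_full_ge[OF pos, of C]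
      by (cases C) auto
    then show ?thesis using full.H_eq[of n C] le_n by blast
  qed
  have "H SR n d k = (if d = 1 then 1 else if k = 1 then d else n) \<and>
      HR SR n d k = (if d = 1 then 1 else if k = 1 then d else n)"
  proof (cases "d = 1 \<or> k = 1")
    case True
    \<comment> \<open>The cases \<open>d = 1\<close> and \<open>k = 1\<close> merge, because the
      claimed value \<open>1\<close> in the first is \<open>d\<close> as well.\<close>
    have "H SR n d k = d \<and> HR SR n d k = d"
      using full.H_eq[OF min_depth_SR_full_ge[OF pos]] min_depth_SR_le_max_length
        min_depth_SR_le_1 True by auto
    with True show ?thesis by auto
  next
    case False
    with pos have gt: "1 < d" "d \<le> n" "1 < k" by auto
    interpret nonzero: rich_uniform_system n d k "\<lambda>c. \<exists>(a, \<delta>)\<in>c. \<delta> \<noteq> 0" g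
      using gt by (rule rich_nonzero_uniform_system)
    show ?thesis
      using nonzero.H_eq[OF min_depth_SR_nonzero_ge[OF gt]] le_n False by auto
  qed
  with n show ?thesis by simp
qed

end
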